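(* For every integer base $p\ge2$, $\mathbf{PREG}_p\subseteq\Sigma_1\text{-}\mathbf{BA}_p$.
   Context: $\Sigma_p=\{0,\dots,p-1\}$; for $w=v_m\cdots v_0\in\Sigma_p^*$, $[\![w]\!]_p=\sum_iv_ip^i$, and $[\![L]\!]_p=\{[\![w]\!]_p:w\in L\}$. A language $L\subseteq\Sigma^*$ has polynomial growth if $d_L(n)=\#(L\cap\Sigma^n)=O(n^c)$ for some constant $c\ge0$. $\mathbf{PREG}_p=\{[\![L]\!]_p: L\subseteq\Sigma_p^*\text{ regular of polynomial growth}\}$. Büchi arithmetic of base $p$ is the first-order theory of $\langle\mathbb{N},0,1,+,V_p\rangle$, where $V_p(a,b)$ holds iff $a$ is the largest power of $p$ dividing $b$, and $V_p(a,0)$ never holds; $\Sigma_1\text{-}\mathbf{BA}_p$ is the family of subsets of $\mathbb{N}$ definable by existential formulas of Büchi arithmetic of base $p$ with one free variable. *)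

theory Defs
  imports Complex_Main "HOL-Library.Landau_Symbols"
begin

section \<open>Regular languages of polynomial growth\<close>

definition dfa_on :: "'a set \<Rightarrow> 's set \<Rightarrow> 's \<Rightarrow> ('s \<Rightarrow> 'a \<Rightarrow> 's) \<Rightarrow> 's set \<Rightarrow> bool" where
  "dfa_on \<Sigma> Q q\<^sub>0 \<delta> F \<longleftrightarrow>
     finite Q \<and> q\<^sub>0 \<in> Q \<and> F \<subseteq> Q \<and> (\<forall>q\<in>Q. \<forall>a\<in>\<Sigma>. \<delta> q a \<in> Q)"

definition dfa_language :: "'a set \<Rightarrow> 's \<Rightarrow> ('s \<Rightarrow> 'a \<Rightarrow> 's) \<Rightarrow> 's set \<Rightarrow> 'a list set" where
  "dfa_language \<Sigma> q\<^sub>0 \<delta> F = {w \<in> lists \<Sigma>. foldl \<delta> q\<^sub>0 w \<in> F}"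

text \<open>States are natural numbers without loss of generality: state sets are finite, and
  \<open>regular_onI\<close> below admits an arbitrary type of states.\<close>

definition regular_on :: "'a set \<Rightarrow> 'a list set \<Rightarrow> bool" where
  "regular_on \<Sigma> L \<longleftrightarrow>
     (\<exists>(Q :: nat set) q\<^sub>0 \<delta> F. dfa_on \<Sigma> Q q\<^sub>0 \<delta> F \<and> L = dfa_language \<Sigma> q\<^sub>0 \<delta> F)"

lemma regular_onI:
  fixes Q :: "'s set"
  assumes dfa: "dfa_on \<Sigma> Q q\<^sub>0 \<delta> F"
  shows "regular_on \<Sigma> (dfa_language \<Sigma> q\<^sub>0 \<delta> F)"
proof -
  have fin: "finite Q" and q0: "q\<^sub>0 \<in> Q" and FQ: "F \<subseteq> Q"
    and step: "\<And>q a. q \<in> Q \<Longrightarrow> a \<in> \<Sigma> \<Longrightarrow> \<delta> q a \<in> Q"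
    using dfa by (auto simp: dfa_on_def)
  obtain f :: "'s \<Rightarrow> nat" where f: "inj_on f Q"
    using finite_imp_inj_to_nat_seg[OF fin] by blast
  define \<delta>' where "\<delta>' = (\<lambda>s a. f (\<delta> (inv_into Q f s) a))"
  have run: "foldl \<delta> q w \<in> Q \<and> foldl \<delta>' (f q) w = f (foldl \<delta> q w)"
    if "w \<in> lists \<Sigma>" "q \<in> Q" for w q
    using that
  proof (induction w arbitrary: q)
    case (Cons a w)
    then show ?case by (simp add: \<delta>'_def f step)
  qed simp
  have "dfa_on \<Sigma> (f ` Q) (f q\<^sub>0) \<delta>' (f ` F)"
    using fin q0 FQ step by (auto simp: dfa_on_def \<delta>'_def f)
  moreover have "dfa_language \<Sigma> q\<^sub>0 \<delta> F = dfa_language \<Sigma> (f q\<^sub>0) \<delta>' (f ` F)"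
  proof -
    have "foldl \<delta>' (f q\<^sub>0) w \<in> f ` F \<longleftrightarrow> foldl \<delta> q\<^sub>0 w \<in> F" if "w \<in> lists \<Sigma>" for w
      using run[OF that q0] inj_on_image_mem_iff[OF f _ FQ] by metis
    then show ?thesis
      unfolding dfa_language_def by blast
  qed
  ultimately show ?thesis
    unfolding regular_on_def by blast
qed

definition growth :: "'a list set \<Rightarrow> nat \<Rightarrow> nat" where
  "growth L n = card {w \<in> L. length w = n}"

definition polynomial_growth :: "'a list set \<Rightarrow> bool" where
  "polynomial_growth L \<longleftrightarrow> (\<exists>c::real. c \<ge> 0 \<and> (\<lambda>n. real (growth L n)) \<in> O(\<lambda>n. real n powr c))"

text \<open>Words are written with the most significant digit first: the list \<open>w\<close> is
  \<open>[v\<^sub>m, \<dots>, v\<^sub>0]\<close>, so that \<open>rev w ! i\<close> is the digit \<open>v\<^sub>i\<close>. The empty word denotes 0, and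
  leading zeros are allowed.\<close>

definition word_val :: "nat \<Rightarrow> nat list \<Rightarrow> nat" where
  "word_val p w = (\<Sum>i<length w. rev w ! i * p ^ i)"

definition PREG :: "nat \<Rightarrow> nat set set" where
  "PREG p = {word_val p ` L | L. regular_on {..<p} L \<and> polynomial_growth L}"


section \<open>Buechi arithmetic\<close>

datatype ba_term = Var nat | Zero | One | Plus ba_term ba_term

datatype ba_form =
    Eq ba_term ba_term
  | V ba_term ba_term
  | Neg ba_form
  | Conj ba_form ba_form
  | Disj ba_form ba_form
  | Ex nat ba_form
  | All nat ba_form

definition V_rel :: "nat \<Rightarrow> nat \<Rightarrow> nat \<Rightarrow> bool" where
  "V_rel p a b \<longleftrightarrow>
     b \<noteq> 0 \<and> (\<exists>k. a = p ^ k) \<and> a dvd b \<and> (\<forall>k. p ^ k dvd b \<longrightarrow> p ^ k \<le> a)"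

primrec tm_val :: "(nat \<Rightarrow> nat) \<Rightarrow> ba_term \<Rightarrow> nat" where
  "tm_val e (Var x) = e x"
| "tm_val e Zero = 0"
| "tm_val e One = 1"
| "tm_val e (Plus s t) = tm_val e s + tm_val e t"

primrec holds :: "nat \<Rightarrow> (nat \<Rightarrow> nat) \<Rightarrow> ba_form \<Rightarrow> bool" where
  "holds p e (Eq s t) \<longleftrightarrow> tm_val e s = tm_val e t"
| "holds p e (V s t) \<longleftrightarrow> V_rel p (tm_val e s) (tm_val e t)"
| "holds p e (Neg \<phi>) \<longleftrightarrow> \<not> holds p e \<phi>"
| "holds p e (Conj \<phi> \<psi>) \<longleftrightarrow> holds p e \<phi> \<and> holds p e \<psi>"
| "holds p e (Disj \<phi> \<psi>) \<longleftrightarrow> holds p e \<phi> \<or> holds p e \<psi>"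
| "holds p e (Ex x \<phi>) \<longleftrightarrow> (\<exists>n. holds p (e(x := n)) \<phi>)"
| "holds p e (All x \<phi>) \<longleftrightarrow> (\<forall>n. holds p (e(x := n)) \<phi>)"

primrec tm_vars :: "ba_term \<Rightarrow> nat set" where
  "tm_vars (Var x) = {x}"
| "tm_vars Zero = {}"
| "tm_vars One = {}"
| "tm_vars (Plus s t) = tm_vars s \<union> tm_vars t"

primrec free_vars :: "ba_form \<Rightarrow> nat set" where
  "free_vars (Eq s t) = tm_vars s \<union> tm_vars t"
| "free_vars (V s t) = tm_vars s \<union> tm_vars t"
| "free_vars (Neg \<phi>) = free_vars \<phi>"
| "free_vars (Conj \<phi> \<psi>) = free_vars \<phi> \<union> free_vars \<psi>"
| "free_vars (Disj \<phi> \<psi>) = free_vars \<phi> \<union> free_vars \<psi>"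
| "free_vars (Ex x \<phi>) = free_vars \<phi> - {x}"
| "free_vars (All x \<phi>) = free_vars \<phi> - {x}"

primrec quantifier_free :: "ba_form \<Rightarrow> bool" where
  "quantifier_free (Eq s t) \<longleftrightarrow> True"
| "quantifier_free (V s t) \<longleftrightarrow> True"
| "quantifier_free (Neg \<phi>) \<longleftrightarrow> quantifier_free \<phi>"
| "quantifier_free (Conj \<phi> \<psi>) \<longleftrightarrow> quantifier_free \<phi> \<and> quantifier_free \<psi>"
| "quantifier_free (Disj \<phi> \<psi>) \<longleftrightarrow> quantifier_free \<phi> \<and> quantifier_free \<psi>"
| "quantifier_free (Ex x \<phi>) \<longleftrightarrow> False"
| "quantifier_free (All x \<phi>) \<longleftrightarrow> False"

inductive existential :: "ba_form \<Rightarrow> bool" where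
  existential_qf: "quantifier_free \<phi> \<Longrightarrow> existential \<phi>"
| existential_Ex: "existential \<phi> \<Longrightarrow> existential (Ex x \<phi>)"

lemma tm_val_cong:
  "(\<And>x. x \<in> tm_vars t \<Longrightarrow> e x = e' x) \<Longrightarrow> tm_val e t = tm_val e' t"
  by (induction t) auto

lemma holds_cong:
  "(\<And>x. x \<in> free_vars \<phi> \<Longrightarrow> e x = e' x) \<Longrightarrow> holds p e \<phi> \<longleftrightarrow> holds p e' \<phi>"
proof (induction \<phi> arbitrary: e e')
  case (Eq s t)
  have "tm_val e s = tm_val e' s" "tm_val e t = tm_val e' t"
    by (rule tm_val_cong, simp add: Eq)+
  then show ?case by simp
next
  case (V s t)
  have "tm_val e s = tm_val e' s" "tm_val e t = tm_val e' t"
    by (rule tm_val_cong, simp add: V)+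
  then show ?case by simp
next
  case (Neg \<phi>)
  have "holds p e \<phi> \<longleftrightarrow> holds p e' \<phi>"
    by (rule Neg.IH) (simp add: Neg.prems)
  then show ?case by simp
next
  case (Conj \<phi> \<psi>)
  have "holds p e \<phi> \<longleftrightarrow> holds p e' \<phi>"
    by (rule Conj.IH(1)) (simp add: Conj.prems)
  moreover have "holds p e \<psi> \<longleftrightarrow> holds p e' \<psi>"
    by (rule Conj.IH(2)) (simp add: Conj.prems)
  ultimately show ?case by simp
next
  case (Disj \<phi> \<psi>)
  have "holds p e \<phi> \<longleftrightarrow> holds p e' \<phi>"
    by (rule Disj.IH(1)) (simp add: Disj.prems)
  moreover have "holds p e \<psi> \<longleftrightarrow> holds p e' \<psi>"
    by (rule Disj.IH(2)) (simp add: Disj.prems)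
  ultimately show ?case by simp
next
  case (Ex x \<phi>)
  have "holds p (e(x := n)) \<phi> \<longleftrightarrow> holds p (e'(x := n)) \<phi>" for n
    by (rule Ex.IH) (simp add: Ex.prems)
  then show ?case by simp
next
  case (All x \<phi>)
  have "holds p (e(x := n)) \<phi> \<longleftrightarrow> holds p (e'(x := n)) \<phi>" for n
    by (rule All.IH) (simp add: All.prems)
  then show ?case by simp
qed

text \<open>By \<open>holds_cong\<close>, the values of the assignment outside \<open>x\<close> are irrelevant here.\<close>

definition Sigma1_BA :: "nat \<Rightarrow> nat set set" where
  "Sigma1_BA p =
     {{n. holds p ((\<lambda>_. 0)(x := n)) \<phi>} | \<phi> x. existential \<phi> \<and> free_vars \<phi> = {x}}"

end

theory Submission
  imports Defs "HOL-Real_Asymp.Real_Asymp"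
begin

text \<open>In a DFA of polynomial growth, a state that is both accessible and co-accessible has at
  most one letter through which it can return to itself, since two return words with different
  first letters could be combined freely. So every word accepted from a state \<open>q\<close> that has a
  return word \<open>u\<close> is a power of \<open>u\<close> followed by a word that leaves the cycle \<open>u\<close>, and a word
  that leaves the cycle never comes back to \<open>q\<close>. Induction on the set of reachable states
  builds the language from \<open>{[]}\<close> by finite unions, prefixing of a letter, and prefixing of all
  powers of a word.

  A word \<open>w\<close> is encoded by the pair of its value and \<open>p ^ length w\<close>. If \<open>x = p ^ length w\<close> and
  \<open>u\<close> has length \<open>l\<close>, then prefixing \<open>u\<close> \<open>n\<close> times adds \<open>word_val p u * z\<close> to the value and
  turns the power into \<open>x + (p ^ l - 1) * z\<close>, where \<open>z = x * (p ^ (l * n) - 1) / (p ^ l - 1)\<close>;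
  and the numbers \<open>z\<close> of this form are exactly those for which \<open>x + (p ^ l - 1) * z\<close> is again a
  power of \<open>p\<close>. Hence each step is linear, and \<open>V\<close> is only needed to say that a number is a
  power of \<open>p\<close>.\<close>


section \<open>Polynomial growth and cycles\<close>

text \<open>Distinct words of equal length form a code, so the \<open>2 ^ n\<close> products of
  \<open>n\<close> factors from \<open>{u, v}\<close> are distinct. Framed by \<open>x\<close> and
  \<open>y\<close> they all have one length, linear in \<open>n\<close>, and no power of it bounds
  \<open>2 ^ n\<close>.\<close>

lemma not_polynomial_growth_if_free_pair:
  assumes "finite \<Sigma>" and "L \<subseteq> lists \<Sigma>"
    and len: "length u = length v" and neq: "u \<noteq> v"
    and pump: "\<And>ws. ws \<in> lists {u, v} \<Longrightarrow> x @ concat ws @ y \<in> L"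
  shows "\<not> polynomial_growth L"
proof
  assume "polynomial_growth L"
  then obtain c :: real where c: "c \<ge> 0" "(\<lambda>n. real (growth L n)) \<in> O(\<lambda>n. real n powr c)"
    unfolding polynomial_growth_def by blast
  define k m where "k = length x + length y" and "m = length u"
  have "m > 0"
    using len neq by (auto simp: m_def)
  have ge: "2 ^ n \<le> growth L (k + m * n)" for n
  proof -
    let ?A = "{ws. set ws \<subseteq> {u, v} \<and> length ws = n}"
    have len': "length (concat ws) = m * n" if "ws \<in> ?A" for ws
    proof -
      have "map length ws = replicate n m"
        using that len by (intro replicate_eqI) (auto simp: m_def)
      then show ?thesis
        by (simp add: length_concat sum_list_replicate)
    qed
    have "inj_on (\<lambda>ws. x @ concat ws @ y) ?A"
    proof (rule inj_onI)
      fix ws ws' assume ws: "ws \<in> ?A" "ws' \<in> ?A" and "x @ concat ws @ y = x @ concat ws' @ y"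
      then have "concat ws = concat ws'"
        by simp
      moreover have "\<forall>(a, b)\<in>set (zip ws ws'). length a = length b"
        using ws len by (fastforce dest: set_zip_leftD set_zip_rightD)
      ultimately show "ws = ws'"
        using ws by (intro concat_injective) auto
    qed
    moreover have "(\<lambda>ws. x @ concat ws @ y) ` ?A \<subseteq> {w \<in> L. length w = k + m * n}"
      using len' by (auto simp: k_def intro!: pump)
    moreover have "finite {w \<in> L. length w = k + m * n}"
      by (rule finite_subset[OF _ finite_lists_length_eq[OF \<open>finite \<Sigma>\<close>, of "k + m * n"]])
        (use \<open>L \<subseteq> lists \<Sigma>\<close> in auto)
    ultimately have "card ?A \<le> growth L (k + m * n)"
      unfolding growth_def by (rule card_inj_on_le)
    then show ?thesis
      using neq by (simp add: card_lists_length_eq numeral_2_eq_2)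
  qed
  \<comment> \<open>The growth bound is restricted to the lengths \<open>k + m * n\<close>, which
    tend to infinity because \<open>m > 0\<close>.\<close>
  have "filterlim (\<lambda>n. k + m * n) at_top at_top"
    by (rule filterlim_at_top_mono[OF filterlim_ident]) (use \<open>m > 0\<close> in \<open>auto simp: trans_le_add2\<close>)
  then have "(\<lambda>n. real (growth L (k + m * n))) \<in> O(\<lambda>n. real (k + m * n) powr c)"
    by (rule landau_o.big.compose[OF c(2)])
  moreover have "(\<lambda>n. 2 ^ n) \<in> O(\<lambda>n. real (growth L (k + m * n)))"
    using of_nat_mono[OF ge, where ?'a = real]
    by (intro bigoI[where c = 1] always_eventually) simp
  ultimately have "(\<lambda>n. 2 ^ n :: real) \<in> O(\<lambda>n. real (k + m * n) powr c)"
    by (rule landau_o.big_trans[rotated])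
  moreover have "(\<lambda>n. real (k + m * n) powr c) \<in> o(\<lambda>n. 2 ^ n)"
  proof -
    have "(\<lambda>n. (a + b * real n) powr c) \<in> o(\<lambda>n. 2 ^ n)" if "b > 0" for a b :: real
      using that c(1) by real_asymp
    from this[of "real m" "real k"] show ?thesis
      using \<open>m > 0\<close> by simp
  qed
  ultimately have "(\<lambda>n. 2 ^ n :: real) \<in> o(\<lambda>n. 2 ^ n)"
    by (rule landau_o.big_small_trans)
  then show False
    by (simp add: landau_o.small_refl_iff)
qed

lemma foldl_concat_fixed:
  assumes "\<And>w. w \<in> set ws \<Longrightarrow> foldl \<delta> q w = q"
  shows "foldl \<delta> q (concat ws) = q"
  using assms by (induction ws) auto

text \<open>Return words of \<open>r\<close> with different first letters, brought to a common
  length, form a free pair between the access word \<open>x\<close> and the accepted continuation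
  \<open>y\<close>.\<close>

lemma return_letter_unique:
  assumes "finite \<Sigma>" and poly: "polynomial_growth (dfa_language \<Sigma> q\<^sub>0 \<delta> F)"
    and x: "x \<in> lists \<Sigma>" "foldl \<delta> q\<^sub>0 x = r"
    and y: "y \<in> lists \<Sigma>" "foldl \<delta> r y \<in> F"
    and u: "a # u \<in> lists \<Sigma>" "foldl \<delta> r (a # u) = r"
    and v: "b # v \<in> lists \<Sigma>" "foldl \<delta> r (b # v) = r"
  shows "a = b"
proof (rule ccontr)
  assume "a \<noteq> b"
  \<comment> \<open>Each return word is repeated as often as the other is long, so both lengths
    equal the product. The first letters still differ.\<close>
  define u' where "u' = concat (replicate (length (b # v)) (a # u))"
  define v' where "v' = concat (replicate (length (a # u)) (b # v))"
  have ret: "foldl \<delta> r u' = r" "foldl \<delta> r v' = r"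
    unfolding u'_def v'_def by (rule foldl_concat_fixed, use u v in auto)+
  have lists: "u' \<in> lists \<Sigma>" "v' \<in> lists \<Sigma>"
    using u v by (auto simp: u'_def v'_def split: if_splits)
  have "length u' = length v'"
    by (simp add: u'_def v'_def length_concat sum_list_replicate)
  moreover have "u' \<noteq> v'"
    using \<open>a \<noteq> b\<close> by (simp add: u'_def v'_def)
  moreover have "x @ concat ws @ y \<in> dfa_language \<Sigma> q\<^sub>0 \<delta> F" if "ws \<in> lists {u', v'}" for ws
  proof -
    have "foldl \<delta> r (concat ws) = r"
      using that ret by (auto intro!: foldl_concat_fixed)
    moreover have "concat ws \<in> lists \<Sigma>"
      using that lists by (auto simp: in_lists_conv_set)
    ultimately show ?thesis
      using x y by (simp add: dfa_language_def)
  qed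
  moreover have "dfa_language \<Sigma> q\<^sub>0 \<delta> F \<subseteq> lists \<Sigma>"
    by (auto simp: dfa_language_def)
  ultimately have "\<not> polynomial_growth (dfa_language \<Sigma> q\<^sub>0 \<delta> F)"
    using not_polynomial_growth_if_free_pair[OF \<open>finite \<Sigma>\<close>] by blast
  with poly show False by simp
qed

text \<open>Copies of \<open>u\<close> are stripped from the front; each strip shortens the word
  since \<open>u\<close> is nonempty.\<close>

lemma power_prefix_decomposition:
  assumes "u \<noteq> []"
  shows "\<exists>n v. w = concat (replicate n u) @ v \<and> \<not> (\<exists>v'. v = u @ v')"
proof (induction w rule: length_induct)
  case (1 w)
  show ?case
  proof (cases "\<exists>v'. w = u @ v'")
    case True
    then obtain w' where w': "w = u @ w'" by blast
    have "\<exists>n v. w' = concat (replicate n u) @ v \<and> \<not> (\<exists>v'. v = u @ v')"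
      using 1 assms by (simp add: w')
    then obtain n v where "w' = concat (replicate n u) @ v" "\<not> (\<exists>v'. v = u @ v')"
      by blast
    then show ?thesis
      using w' by (intro exI[of _ "Suc n"] exI[of _ v]) simp
  next
    case False
    then show ?thesis by (intro exI[of _ 0] exI[of _ w]) simp
  qed
qed

text \<open>These closure properties are all that the automata argument needs; \<open>P\<close>
  later becomes definability of the encoded language.\<close>

locale language_closure =
  fixes \<Sigma> :: "'a set" and P :: "'a list set \<Rightarrow> bool"
  assumes finite_alphabet: "finite \<Sigma>"
    and closed_empty: "P {}"
    and closed_Nil: "P {[]}"
    and closed_Un: "P A \<Longrightarrow> P B \<Longrightarrow> P (A \<union> B)"
    and closed_Cons: "a \<in> \<Sigma> \<Longrightarrow> P A \<Longrightarrow> P ((#) a ` A)"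
    and closed_power: "u \<in> lists \<Sigma> \<Longrightarrow> u \<noteq> [] \<Longrightarrow> P A \<Longrightarrow>
      P {concat (replicate n u) @ w | n w. w \<in> A}"
begin

lemma closed_UN: "finite I \<Longrightarrow> (\<And>i. i \<in> I \<Longrightarrow> P (A i)) \<Longrightarrow> P (\<Union>i\<in>I. A i)"
  by (induction I rule: finite_induct) (auto intro: closed_empty closed_Un)

text \<open>A word without the prefix \<open>u\<close> is a proper prefix of \<open>u\<close>, or it
  follows some \<open>u\<^sub>1\<close> and then reads \<open>b\<close> in place of the next letter
  \<open>a\<close> of \<open>u\<close>. There are finitely many such departures.\<close>

lemma closed_off_cycle:
  assumes "u \<in> lists \<Sigma>"
    and "\<And>u\<^sub>1 a u\<^sub>2 b. u = u\<^sub>1 @ a # u\<^sub>2 \<Longrightarrow> b \<in> \<Sigma> \<Longrightarrow> b \<noteq> a \<Longrightarrow>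
      P (dfa_language \<Sigma> (foldl \<delta> q (u\<^sub>1 @ [b])) \<delta> F)"
  shows "P {w \<in> dfa_language \<Sigma> q \<delta> F. \<not> (\<exists>v. w = u @ v)}"
  using assms
proof (induction u arbitrary: q rule: list.induct)
  case Nil
  then show ?case by (simp add: closed_empty)
next
  case (Cons a u)
  \<comment> \<open>A word stops at \<open>q\<close> (\<open>?N\<close>), reads \<open>a\<close> and
    fails to continue with \<open>u\<close> (\<open>?A\<close>), or departs at once with another
    letter (\<open>?B\<close>).\<close>
  let ?N = "if q \<in> F then {[]} else {}"
  let ?A = "(#) a ` {w \<in> dfa_language \<Sigma> (\<delta> q a) \<delta> F. \<not> (\<exists>v. w = u @ v)}"
  let ?B = "\<Union>b\<in>\<Sigma> - {a}. (#) b ` dfa_language \<Sigma> (\<delta> q b) \<delta> F"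
  have "P {w \<in> dfa_language \<Sigma> (\<delta> q a) \<delta> F. \<not> (\<exists>v. w = u @ v)}"
  proof (rule Cons.IH)
    show "u \<in> lists \<Sigma>" using Cons.prems(1) by simp
    show "P (dfa_language \<Sigma> (foldl \<delta> (\<delta> q a) (u\<^sub>1 @ [b])) \<delta> F)"
      if "u = u\<^sub>1 @ a' # u\<^sub>2" "b \<in> \<Sigma>" "b \<noteq> a'" for u\<^sub>1 a' u\<^sub>2 b
      using Cons.prems(2)[of "a # u\<^sub>1" a' u\<^sub>2 b] that by simp
  qed
  then have "P ?A"
    using Cons.prems(1) by (intro closed_Cons) auto
  moreover have "P ?B"
    using finite_alphabet Cons.prems(2)[of "[]" a u] by (intro closed_UN closed_Cons) auto
  moreover have "P ?N"
    by (simp add: closed_empty closed_Nil)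
  ultimately have "P (?N \<union> (?A \<union> ?B))"
    by (intro closed_Un)
  also have "?N \<union> (?A \<union> ?B) = {w \<in> dfa_language \<Sigma> q \<delta> F. \<not> (\<exists>v. w = (a # u) @ v)}"
    (is "_ = ?R")
  proof (rule set_eqI)
    fix w show "w \<in> ?N \<union> (?A \<union> ?B) \<longleftrightarrow> w \<in> ?R"
      using Cons.prems(1) by (cases w) (auto simp: dfa_language_def)
  qed
  finally show ?case .
qed

lemma closed_one_step:
  assumes "\<And>b. b \<in> \<Sigma> \<Longrightarrow> P (dfa_language \<Sigma> (\<delta> q b) \<delta> F)"
  shows "P (dfa_language \<Sigma> q \<delta> F)"
proof -
  let ?N = "if q \<in> F then {[]} else {}"
  let ?B = "\<Union>b\<in>\<Sigma>. (#) b ` dfa_language \<Sigma> (\<delta> q b) \<delta> F"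
  have "P (?N \<union> ?B)"
    using assms finite_alphabet
    by (intro closed_Un closed_UN closed_Cons) (auto simp: closed_empty closed_Nil)
  also have "?N \<union> ?B = dfa_language \<Sigma> q \<delta> F" (is "_ = ?R")
  proof (rule set_eqI)
    fix w show "w \<in> ?N \<union> ?B \<longleftrightarrow> w \<in> ?R"
      by (cases w) (auto simp: dfa_language_def)
  qed
  finally show ?thesis .
qed

text \<open>Since \<open>u\<close> returns to \<open>q\<close>, prefixing or stripping powers of
  \<open>u\<close> does not change acceptance from \<open>q\<close>.\<close>

lemma closed_cycle:
  assumes u: "u \<in> lists \<Sigma>" "u \<noteq> []" "foldl \<delta> q u = q"
    and "P {w \<in> dfa_language \<Sigma> q \<delta> F. \<not> (\<exists>v. w = u @ v)}" (is "P ?X")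
  shows "P (dfa_language \<Sigma> q \<delta> F)"
proof -
  have ret: "foldl \<delta> q (concat (replicate n u)) = q" for n
    using u by (intro foldl_concat_fixed) auto
  have "{concat (replicate n u) @ w | n w. w \<in> ?X} = dfa_language \<Sigma> q \<delta> F"
  proof (intro equalityI subsetI)
    fix w assume "w \<in> {concat (replicate n u) @ w | n w. w \<in> ?X}"
    then show "w \<in> dfa_language \<Sigma> q \<delta> F"
      using u ret by (auto simp: dfa_language_def)
  next
    fix w assume w: "w \<in> dfa_language \<Sigma> q \<delta> F"
    obtain n v where "w = concat (replicate n u) @ v" "\<not> (\<exists>v'. v = u @ v')"
      using power_prefix_decomposition[OF \<open>u \<noteq> []\<close>] by blast
    then show "w \<in> {concat (replicate n u) @ w | n w. w \<in> ?X}"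
      using w ret by (auto simp: dfa_language_def)
  qed
  then show ?thesis
    using closed_power[OF u(1,2) assms(4)] by simp
qed

theorem closed_polynomial_growth:
  assumes dfa: "dfa_on \<Sigma> Q q\<^sub>0 \<delta> F"
    and poly: "polynomial_growth (dfa_language \<Sigma> q\<^sub>0 \<delta> F)"
  shows "P (dfa_language \<Sigma> q\<^sub>0 \<delta> F)"
proof -
  define R where "R = (\<lambda>q. foldl \<delta> q ` lists \<Sigma>)"
  have run: "foldl \<delta> q w \<in> Q" if "q \<in> Q" "w \<in> lists \<Sigma>" for q w
    using that dfa by (induction w arbitrary: q) (auto simp: dfa_on_def)
  have fin: "finite (R q)" if "q \<in> Q" for q
    using dfa run[OF that] by (auto simp: R_def dfa_on_def intro: finite_subset[of _ Q])
  have R_trans: "r' \<in> R q" if r: "r \<in> R q" and r': "r' \<in> R r" for q r r'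
  proof -
    obtain u v where "u \<in> lists \<Sigma>" "r = foldl \<delta> q u" "v \<in> lists \<Sigma>" "r' = foldl \<delta> r v"
      using r r' by (auto simp: R_def)
    then show ?thesis
      unfolding R_def by (intro image_eqI[of _ _ "u @ v"]) auto
  qed
  \<comment> \<open>The state is kept in the form \<open>foldl \<delta> q\<^sub>0 x\<close> because
    uniqueness of return letters needs accessibility from \<open>q\<^sub>0\<close>.\<close>
  have "P (dfa_language \<Sigma> (foldl \<delta> q\<^sub>0 x) \<delta> F)" if "x \<in> lists \<Sigma>" for x
    using that
  proof (induction "card (R (foldl \<delta> q\<^sub>0 x))" arbitrary: x rule: less_induct)
    case less
    define q where "q = foldl \<delta> q\<^sub>0 x"
    have "q \<in> Q"
      using run less.prems dfa by (simp add: q_def dfa_on_def)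
    \<comment> \<open>A state reachable from \<open>q\<close> that cannot return to \<open>q\<close>
      reaches strictly fewer states: it loses \<open>q\<close> itself.\<close>
    have smaller: "P (dfa_language \<Sigma> (foldl \<delta> q v) \<delta> F)"
      if "v \<in> lists \<Sigma>" "q \<notin> R (foldl \<delta> q v)" for v
    proof -
      have "foldl \<delta> q v \<in> R q"
        using that by (auto simp: R_def)
      then have "R (foldl \<delta> q v) \<subseteq> R q"
        using R_trans by blast
      moreover have "q \<in> R q"
        unfolding R_def by (rule image_eqI[of _ _ "[]"]) auto
      ultimately have "R (foldl \<delta> q v) \<subset> R q"
        using that by blast
      then have "card (R (foldl \<delta> q v)) < card (R q)"
        by (intro psubset_card_mono fin \<open>q \<in> Q\<close>)
      then show ?thesis
        using less.hyps[of "x @ v"] less.prems that(1) by (simp add: q_def)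
    qed
    show ?case
    proof (cases "\<exists>u\<in>lists \<Sigma>. u \<noteq> [] \<and> foldl \<delta> q u = q")
      case False
      have "q \<notin> R (\<delta> q b)" if "b \<in> \<Sigma>" for b
      proof
        assume "q \<in> R (\<delta> q b)"
        then obtain v where v: "v \<in> lists \<Sigma>" "q = foldl \<delta> (\<delta> q b) v"
          by (auto simp: R_def)
        with False have "b # v \<notin> lists \<Sigma> \<or> foldl \<delta> q (b # v) \<noteq> q"
          by blast
        with v that show False by simp
      qed
      then have "P (dfa_language \<Sigma> (\<delta> q b) \<delta> F)" if "b \<in> \<Sigma>" for b
        using smaller[of "[b]"] that by simp
      then show ?thesis
        unfolding q_def by (rule closed_one_step)
    next
      case True
      then obtain u where u: "u \<in> lists \<Sigma>" "u \<noteq> []" "foldl \<delta> q u = q" by blast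
      have "P (dfa_language \<Sigma> (foldl \<delta> q (u\<^sub>1 @ [b])) \<delta> F)"
        if u_eq: "u = u\<^sub>1 @ a # u\<^sub>2" and b: "b \<in> \<Sigma>" "b \<noteq> a" for u\<^sub>1 a u\<^sub>2 b
      \<comment> \<open>If nothing is accepted after the departure, uniqueness of return letters
        does not apply, but the language is empty.\<close>
      proof (cases "dfa_language \<Sigma> (foldl \<delta> q (u\<^sub>1 @ [b])) \<delta> F = {}")
        case True
        then show ?thesis by (simp only: closed_empty)
      next
        case False
        then obtain y where y: "y \<in> lists \<Sigma>" "foldl \<delta> (foldl \<delta> q (u\<^sub>1 @ [b])) y \<in> F"
          by (auto simp: dfa_language_def)
        define r where "r = foldl \<delta> q u\<^sub>1"
        have u12: "u\<^sub>1 \<in> lists \<Sigma>" "a \<in> \<Sigma>" "u\<^sub>2 \<in> lists \<Sigma>"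
          using u(1) u_eq by auto
        have "q \<notin> R (foldl \<delta> q (u\<^sub>1 @ [b]))"
        proof
          assume "q \<in> R (foldl \<delta> q (u\<^sub>1 @ [b]))"
          then obtain v where v: "v \<in> lists \<Sigma>" "q = foldl \<delta> (\<delta> r b) v"
            by (auto simp: R_def r_def)
          \<comment> \<open>From the point of departure \<open>r\<close>, the word
            \<open>a # (u\<^sub>2 @ u\<^sub>1)\<close> goes once round the cycle, while
            \<open>b # (v @ u\<^sub>1)\<close> leaves it, comes back to \<open>q\<close> and walks
            on to \<open>r\<close>. The word \<open>b # y\<close> shows that \<open>r\<close> is
            co-accessible.\<close>
          have "a = b"
          proof (rule return_letter_unique[OF finite_alphabet poly])
            show "x @ u\<^sub>1 \<in> lists \<Sigma>" "foldl \<delta> q\<^sub>0 (x @ u\<^sub>1) = r"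
              using less.prems u12 by (simp_all add: r_def q_def)
            show "b # y \<in> lists \<Sigma>" "foldl \<delta> r (b # y) \<in> F"
              using y b by (simp_all add: r_def)
            show "a # (u\<^sub>2 @ u\<^sub>1) \<in> lists \<Sigma>" "b # (v @ u\<^sub>1) \<in> lists \<Sigma>"
              using u12 v b by simp_all
            show "foldl \<delta> r (a # (u\<^sub>2 @ u\<^sub>1)) = r"
              using u(3) u_eq by (simp add: r_def)
            show "foldl \<delta> r (b # (v @ u\<^sub>1)) = r"
              by (simp add: v(2)[symmetric]) (simp add: r_def)
          qed
          with b show False by simp
        qed
        then show ?thesis
          using u12 b by (intro smaller) auto
      qed
      then have "P {w \<in> dfa_language \<Sigma> q \<delta> F. \<not> (\<exists>v. w = u @ v)}"
        using u(1) by (rule closed_off_cycle[rotated])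
      then show ?thesis
        using closed_cycle[OF u] by (simp add: q_def)
    qed
  qed
  from this[of "[]"] show ?thesis by simp
qed

end


section \<open>Values of words\<close>

lemma word_val_Nil [simp]: "word_val p [] = 0"
  by (simp add: word_val_def)

lemma word_val_Cons: "word_val p (a # w) = a * p ^ length w + word_val p w"
  by (simp add: word_val_def nth_append)

lemma word_val_append: "word_val p (u @ v) = word_val p u * p ^ length v + word_val p v"
  by (induction u) (simp_all add: word_val_Cons power_add algebra_simps)

text \<open>A copy of \<open>u\<close> with \<open>i\<close> copies to its right is shifted by
  \<open>length w + length u * i\<close> places, so the copies contribute a geometric sum.\<close>

lemma word_val_power_append:
  "word_val p (concat (replicate n u) @ w) =
     word_val p w + word_val p u * (p ^ length w * (\<Sum>i<n. p ^ (length u * i)))"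
proof (induction n)
  case (Suc n)
  have "length (concat (replicate n u)) = length u * n"
    by (simp add: length_concat sum_list_replicate)
  then show ?case
    using Suc by (simp add: word_val_append power_add algebra_simps)
qed simp

section \<open>Geometric sums and divisibility between numbers \<open>p ^ m - 1\<close>\<close>

lemma geometric_sum_nat:
  fixes b :: nat
  assumes "b > 0"
  shows "(b - 1) * (\<Sum>i<n. b ^ i) + 1 = b ^ n"
proof -
  obtain d where "b = Suc d"
    using assms gr0_implies_Suc by blast
  then show ?thesis
    by (induction n) (simp_all add: algebra_simps)
qed

text \<open>With \<open>j = length w\<close> and \<open>l = length u\<close>, the factor that
  measures the change of value in \<open>word_val_power_append\<close> also measures the change of
  \<open>p ^ length w\<close>.\<close>

lemma power_plus_geometric_sum:
  fixes p :: nat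
  assumes "p > 0"
  shows "p ^ j + (p ^ l - 1) * (p ^ j * (\<Sum>i<n. p ^ (l * i))) = p ^ (j + l * n)"
proof -
  have "p ^ (j + l * n) = p ^ j * ((p ^ l - 1) * (\<Sum>i<n. p ^ (l * i)) + 1)"
    using geometric_sum_nat[of "p ^ l" n] assms by (simp only: power_add power_mult) simp
  then show ?thesis
    by (simp only: distrib_left mult_1_right mult.left_commute add.commute)
qed

text \<open>Modulo \<open>p ^ l - 1\<close> exponents reduce modulo \<open>l\<close>. The remainder
  \<open>r\<close> gives \<open>p ^ r - 1 < p ^ l - 1\<close>, so divisibility forces
  \<open>r = 0\<close>.\<close>

lemma power_minus_one_dvd_power_minus_one:
  fixes p :: nat
  assumes "p \<ge> 2" and dvd: "(p ^ l - 1) dvd (p ^ m - 1)"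
  shows "l dvd m"
proof -
  have exp_0: "k = 0" if "p ^ k - 1 = 0" for k
    using that power_le_imp_le_exp[of p k 0] \<open>p \<ge> 2\<close> by simp
  show ?thesis
  proof (cases "l = 0")
    case True
    then show ?thesis using dvd exp_0[of m] by simp
  next
    case False
    define r n where "r = m mod l" and "n = m div l"
    have m: "m = l * n + r" by (simp add: r_def n_def)
    have "r < l" using False by (simp add: r_def)
    have "p ^ (l * n) = (p ^ l - 1) * (\<Sum>i<n. (p ^ l) ^ i) + 1"
      using geometric_sum_nat[of "p ^ l" n] assms by (simp add: power_mult)
    then have "p ^ m - 1 = (p ^ l - 1) * ((\<Sum>i<n. (p ^ l) ^ i) * p ^ r) + (p ^ r - 1)"
      using assms by (simp add: m power_add algebra_simps)
    then have "(p ^ l - 1) dvd (p ^ r - 1)"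
      using dvd by (metis dvd_add_right_iff dvd_triv_left)
    moreover have "p ^ r - 1 < p ^ l - 1"
      using \<open>r < l\<close> assms by (intro diff_less_mono power_strict_increasing) auto
    ultimately have "p ^ r - 1 = 0"
      using dvd_imp_le by fastforce
    then have "r = 0"
      by (rule exp_0)
    then show ?thesis by (simp add: m)
  qed
qed

text \<open>This removes the exponent \<open>n\<close>. If the left side is
  \<open>p ^ (j + m)\<close>, then \<open>p ^ l - 1\<close> divides
  \<open>p ^ j * (p ^ m - 1)\<close>, hence \<open>p ^ m - 1\<close> by coprimality; so
  \<open>l\<close> divides \<open>m\<close>, and cancelling determines \<open>z\<close>.\<close>

lemma power_plus_multiple_is_power_iff:
  fixes p :: nat
  assumes "p \<ge> 2" and "l > 0"
  shows "(\<exists>k. p ^ j + (p ^ l - 1) * z = p ^ k) \<longleftrightarrow> (\<exists>n. z = p ^ j * (\<Sum>i<n. p ^ (l * i)))"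
proof -
  have shift: "p ^ j + (p ^ l - 1) * (p ^ j * (\<Sum>i<n. p ^ (l * i))) = p ^ (j + l * n)" for n
    using power_plus_geometric_sum assms by simp
  show ?thesis
  proof
    assume "\<exists>n. z = p ^ j * (\<Sum>i<n. p ^ (l * i))"
    then show "\<exists>k. p ^ j + (p ^ l - 1) * z = p ^ k"
      using shift by blast
  next
    assume "\<exists>k. p ^ j + (p ^ l - 1) * z = p ^ k"
    then obtain k where k: "p ^ j + (p ^ l - 1) * z = p ^ k" by blast
    then have "p ^ j \<le> p ^ k" by linarith
    then have "j \<le> k"
      using assms by simp
    then obtain m where m: "k = j + m"
      using le_Suc_ex by blast
    have "(p ^ l - 1) * z = p ^ k - p ^ j"
      using k by linarith
    then have "(p ^ l - 1) * z = p ^ j * (p ^ m - 1)"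
      by (simp add: m power_add diff_mult_distrib2)
    then have "(p ^ l - 1) dvd p ^ j * (p ^ m - 1)"
      by (metis dvd_triv_left)
    moreover have "coprime (p ^ l - 1) (p ^ j)"
    proof -
      have "coprime (p ^ l - 1) (p ^ l)"
        using assms by (intro coprime_diff_one_left_nat) simp
      then show ?thesis
        using \<open>l > 0\<close> by simp
    qed
    ultimately have "(p ^ l - 1) dvd (p ^ m - 1)"
      by (simp add: coprime_dvd_mult_right_iff)
    then have "l dvd m"
      by (rule power_minus_one_dvd_power_minus_one[OF \<open>p \<ge> 2\<close>])
    then obtain n where n: "m = l * n"
      by (rule dvdE)
    have "(p ^ l - 1) * z = (p ^ l - 1) * (p ^ j * (\<Sum>i<n. p ^ (l * i)))"
      using k shift[of n] unfolding m n by linarith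
    moreover have "p ^ l > 1"
      by (rule one_less_power) (use assms in auto)
    ultimately have "z = p ^ j * (\<Sum>i<n. p ^ (l * i))"
      unfolding mult_cancel1 by linarith
    then show "\<exists>n. z = p ^ j * (\<Sum>i<n. p ^ (l * i))"
      by (rule exI)
  qed
qed


section \<open>Existential definability\<close>

text \<open>A power of \<open>p\<close> divides itself, and no larger number divides it.\<close>

lemma V_rel_self_iff:
  assumes "p \<ge> 2"
  shows "V_rel p a a \<longleftrightarrow> (\<exists>k. a = p ^ k)"
  using assms by (auto simp: V_rel_def intro: dvd_imp_le)

section \<open>Fresh variables and quantifier prefixes\<close>

lemma finite_tm_vars: "finite (tm_vars t)"
  by (induction t) auto

lemma finite_free_vars: "finite (free_vars \<phi>)"
  by (induction \<phi>) (auto simp: finite_tm_vars)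

primrec tm_mult :: "nat \<Rightarrow> ba_term \<Rightarrow> ba_term" where
  "tm_mult 0 t = Zero"
| "tm_mult (Suc n) t = Plus t (tm_mult n t)"

lemma tm_val_mult [simp]: "tm_val e (tm_mult n t) = n * tm_val e t"
  by (induction n) auto

lemma tm_val_upd_fresh: "x \<notin> tm_vars t \<Longrightarrow> tm_val (e(x := n)) t = tm_val e t"
  by (rule tm_val_cong) auto

lemma holds_upd_fresh: "x \<notin> free_vars \<phi> \<Longrightarrow> holds p (e(x := n)) \<phi> = holds p e \<phi>"
  by (rule holds_cong) auto

text \<open>Variables are bound one at a time. Describing the result by assignments that agree off
  \<open>X\<close> makes the order of the prefix irrelevant.\<close>

lemma existential_closure:
  assumes "existential \<phi>" and "finite X"
  obtains \<psi> where "existential \<psi>" "free_vars \<psi> = free_vars \<phi> - X"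
    "\<And>e. holds p e \<psi> \<longleftrightarrow> (\<exists>e'. (\<forall>x. x \<notin> X \<longrightarrow> e' x = e x) \<and> holds p e' \<phi>)"
proof -
  have "\<exists>\<psi>. existential \<psi> \<and> free_vars \<psi> = free_vars \<phi> - X \<and>
    (\<forall>e. holds p e \<psi> \<longleftrightarrow> (\<exists>e'. (\<forall>x. x \<notin> X \<longrightarrow> e' x = e x) \<and> holds p e' \<phi>))"
    using assms(2)
  proof (induction X rule: finite_induct)
    case empty
    have "e' = e" if "\<forall>x. e' x = e x" for e e' :: "nat \<Rightarrow> nat"
      using that by auto
    then show ?case
      using assms(1) by auto
  next
    case (insert y X)
    then obtain \<psi> where \<psi>: "existential \<psi>" "free_vars \<psi> = free_vars \<phi> - X"
      "\<And>e. holds p e \<psi> \<longleftrightarrow> (\<exists>e'. (\<forall>x. x \<notin> X \<longrightarrow> e' x = e x) \<and> holds p e' \<phi>)"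
      by blast
    have "holds p e (Ex y \<psi>) \<longleftrightarrow> (\<exists>e'. (\<forall>x. x \<notin> insert y X \<longrightarrow> e' x = e x) \<and> holds p e' \<phi>)" for e
    proof
      assume "holds p e (Ex y \<psi>)"
      then obtain n e' where "\<forall>x. x \<notin> X \<longrightarrow> e' x = (e(y := n)) x" "holds p e' \<phi>"
        using \<psi>(3) by auto
      then show "\<exists>e'. (\<forall>x. x \<notin> insert y X \<longrightarrow> e' x = e x) \<and> holds p e' \<phi>"
        by (intro exI[of _ e']) auto
    next
      assume "\<exists>e'. (\<forall>x. x \<notin> insert y X \<longrightarrow> e' x = e x) \<and> holds p e' \<phi>"
      then obtain e' where "\<forall>x. x \<notin> insert y X \<longrightarrow> e' x = e x" "holds p e' \<phi>"
        by blast
      then have "holds p (e(y := e' y)) \<psi>"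
        unfolding \<psi>(3) by (intro exI[of _ e']) auto
      then show "holds p e (Ex y \<psi>)" by auto
    qed
    then show ?case
      using \<psi>(1,2) by (intro exI[of _ "Ex y \<psi>"]) (auto intro: existential_Ex)
  qed
  then show thesis
    using that by blast
qed

text \<open>A fresh variable \<open>x\<close> is equated with \<open>s\<close>, and all other
  variables are bound existentially.\<close>

lemma Sigma1_BA_term_image:
  assumes "quantifier_free \<phi>"
  shows "{tm_val e s | e. holds p e \<phi>} \<in> Sigma1_BA p"
proof -
  have "finite (free_vars \<phi> \<union> tm_vars s)"
    by (simp add: finite_free_vars finite_tm_vars)
  then obtain x where x: "x \<notin> free_vars \<phi> \<union> tm_vars s"
    by (rule exE[OF ex_new_if_finite[OF infinite_UNIV_nat]])
  define X where "X = free_vars \<phi> \<union> tm_vars s"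
  obtain \<psi> where \<psi>: "existential \<psi>"
    "free_vars \<psi> = free_vars (Conj (Eq (Var x) s) \<phi>) - X"
    "\<And>e. holds p e \<psi> \<longleftrightarrow>
      (\<exists>e'. (\<forall>x. x \<notin> X \<longrightarrow> e' x = e x) \<and> holds p e' (Conj (Eq (Var x) s) \<phi>))"
    by (rule existential_closure[of "Conj (Eq (Var x) s) \<phi>" X p])
      (use assms in \<open>auto simp: X_def finite_free_vars finite_tm_vars intro: existential_qf\<close>)
  have "holds p ((\<lambda>_. 0)(x := n)) \<psi> \<longleftrightarrow> (\<exists>e. n = tm_val e s \<and> holds p e \<phi>)" for n
  proof
    assume "holds p ((\<lambda>_. 0)(x := n)) \<psi>"
    then obtain e where "\<forall>y. y \<notin> X \<longrightarrow> e y = ((\<lambda>_. 0)(x := n)) y" "e x = tm_val e s" "holds p e \<phi>"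
      unfolding \<psi>(3) by auto
    then show "\<exists>e. n = tm_val e s \<and> holds p e \<phi>"
      using x by (intro exI[of _ e]) (auto simp: X_def)
  next
    assume "\<exists>e. n = tm_val e s \<and> holds p e \<phi>"
    then obtain e where e: "n = tm_val e s" "holds p e \<phi>" by blast
    \<comment> \<open>The witness \<open>e\<close> is kept on the bound variables; elsewhere
      \<open>e'\<close> must be \<open>n\<close> at \<open>x\<close> and the default 0.\<close>
    define e' where "e' = (\<lambda>y. if y \<in> X then e y else ((\<lambda>_. 0)(x := n)) y)"
    have "tm_val e' s = tm_val e s" "holds p e' \<phi> = holds p e \<phi>"
      by (auto intro!: tm_val_cong holds_cong simp: e'_def X_def)
    moreover have "e' x = n"
      using x by (simp add: e'_def X_def)
    ultimately show "holds p ((\<lambda>_. 0)(x := n)) \<psi>"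
      unfolding \<psi>(3) using e by (intro exI[of _ e']) (auto simp: e'_def)
  qed
  then have "{tm_val e s | e. holds p e \<phi>} = {n. holds p ((\<lambda>_. 0)(x := n)) \<psi>}"
    by blast
  \<comment> \<open>The equation makes \<open>x\<close> occur even if \<open>\<phi>\<close> and
    \<open>s\<close> are closed.\<close>
  moreover have "free_vars \<psi> = {x}"
    using \<psi>(2) x by (auto simp: X_def)
  ultimately show ?thesis
    unfolding Sigma1_BA_def using \<psi>(1) by blast
qed

text \<open>In this parametric form all variables are implicitly quantified existentially. Linear
  maps then change only the terms, and no prenex form has to be restored.\<close>

definition pairs_definable :: "nat \<Rightarrow> (nat \<times> nat) set \<Rightarrow> bool" where
  "pairs_definable p A \<longleftrightarrow>
     (\<exists>\<phi> s t. quantifier_free \<phi> \<and> A = {(tm_val e s, tm_val e t) | e. holds p e \<phi>})"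

lemma pairs_definable_empty: "pairs_definable p {}"
  unfolding pairs_definable_def by (rule exI[of _ "Neg (Eq Zero Zero)"]) simp

lemma pairs_definable_zero_one: "pairs_definable p {(0, 1)}"
  unfolding pairs_definable_def
  by (rule exI[of _ "Eq Zero Zero"], rule exI[of _ Zero], rule exI[of _ One]) simp

text \<open>Fresh \<open>x\<close> and \<open>y\<close> carry the values of either pair of terms.
  Variables shared by the two formulas do no harm, as only one disjunct has to hold.\<close>

lemma pairs_definable_Un:
  assumes "pairs_definable p A" and "pairs_definable p B"
  shows "pairs_definable p (A \<union> B)"
proof -
  obtain \<phi> s t where A: "quantifier_free \<phi>" "A = {(tm_val e s, tm_val e t) | e. holds p e \<phi>}"
    using assms(1) unfolding pairs_definable_def by blast
  obtain \<phi>' s' t' where B: "quantifier_free \<phi>'" "B = {(tm_val e s', tm_val e t') | e. holds p e \<phi>'}"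
    using assms(2) unfolding pairs_definable_def by blast
  let ?X = "free_vars \<phi> \<union> tm_vars s \<union> tm_vars t \<union> free_vars \<phi>' \<union> tm_vars s' \<union> tm_vars t'"
  have "finite ?X"
    by (simp add: finite_free_vars finite_tm_vars)
  then obtain x y where x: "x \<notin> ?X" and "y \<notin> insert x ?X"
    by (meson ex_new_if_finite finite_insert infinite_UNIV_nat)
  then have y: "y \<notin> ?X" "y \<noteq> x"
    by auto
  define \<psi> where "\<psi> = Disj (Conj \<phi> (Conj (Eq (Var x) s) (Eq (Var y) t)))
    (Conj \<phi>' (Conj (Eq (Var x) s') (Eq (Var y) t')))"
  have "A \<union> B = {(tm_val e (Var x), tm_val e (Var y)) | e. holds p e \<psi>}" (is "_ = ?R")
  proof (intro equalityI subsetI)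
    fix ab assume "ab \<in> A \<union> B"
    then obtain e where "holds p e \<phi> \<and> ab = (tm_val e s, tm_val e t) \<or>
        holds p e \<phi>' \<and> ab = (tm_val e s', tm_val e t')"
      using A(2) B(2) by blast
    then have "holds p (e(x := fst ab, y := snd ab)) \<psi>"
      using x y by (auto simp: \<psi>_def tm_val_upd_fresh holds_upd_fresh)
    then show "ab \<in> ?R"
      using y by (intro CollectI exI[of _ "e(x := fst ab, y := snd ab)"]) simp
  next
    fix ab assume "ab \<in> ?R"
    then show "ab \<in> A \<union> B"
      using A(2) B(2) by (auto simp: \<psi>_def)
  qed
  then show ?thesis
    unfolding pairs_definable_def using A(1) B(1)
    by (intro exI[of _ \<psi>] exI[of _ "Var x"] exI[of _ "Var y"]) (simp add: \<psi>_def)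
qed

text \<open>Covers prefixing a letter: \<open>c\<close> is the letter and
  \<open>d = p\<close>.\<close>

lemma pairs_definable_linear:
  assumes "pairs_definable p A"
  shows "pairs_definable p ((\<lambda>(a, x). (a + c * x, d * x)) ` A)"
proof -
  obtain \<phi> s t where A: "quantifier_free \<phi>" "A = {(tm_val e s, tm_val e t) | e. holds p e \<phi>}"
    using assms unfolding pairs_definable_def by blast
  then show ?thesis
    unfolding pairs_definable_def
    by (intro exI[of _ \<phi>] exI[of _ "Plus s (tm_mult c t)"] exI[of _ "tm_mult d t"])
      (auto simp: image_iff)
qed

text \<open>Covers prefixing all powers of \<open>u\<close>, with \<open>c = word_val p u\<close>
  and \<open>d = p ^ length u - 1\<close>. A fresh variable ranges over \<open>z\<close>, and the
  diagonal of \<open>V_rel\<close> says that the new second component is a power of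
  \<open>p\<close>.\<close>

lemma pairs_definable_V:
  assumes "pairs_definable p A"
  shows "pairs_definable p
    {(a + c * z, x + d * z) | a x z. (a, x) \<in> A \<and> V_rel p (x + d * z) (x + d * z)}"
    (is "pairs_definable p ?B")
proof -
  obtain \<phi> s t where A: "quantifier_free \<phi>" "A = {(tm_val e s, tm_val e t) | e. holds p e \<phi>}"
    using assms unfolding pairs_definable_def by blast
  have "finite (free_vars \<phi> \<union> tm_vars s \<union> tm_vars t)"
    by (simp add: finite_free_vars finite_tm_vars)
  then obtain y where y: "y \<notin> free_vars \<phi> \<union> tm_vars s \<union> tm_vars t"
    by (rule exE[OF ex_new_if_finite[OF infinite_UNIV_nat]])
  define s' t' where "s' = Plus s (tm_mult c (Var y))" and "t' = Plus t (tm_mult d (Var y))"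
  have "?B = {(tm_val e s', tm_val e t') | e. holds p e (Conj \<phi> (V t' t'))}" (is "_ = ?R")
  proof (intro equalityI subsetI)
    fix b assume "b \<in> ?B"
    then obtain a x z where b: "(a, x) \<in> A" "b = (a + c * z, x + d * z)"
      "V_rel p (x + d * z) (x + d * z)"
      by blast
    obtain e where e: "holds p e \<phi>" "a = tm_val e s" "x = tm_val e t"
      using b(1) unfolding A(2) by blast
    have "tm_val (e(y := z)) s' = a + c * z" "tm_val (e(y := z)) t' = x + d * z"
      "holds p (e(y := z)) \<phi>"
      using y e by (simp_all add: s'_def t'_def tm_val_upd_fresh holds_upd_fresh)
    then show "b \<in> ?R"
      using b(2,3) by (intro CollectI exI[of _ "e(y := z)"]) simp
  next
    fix b assume "b \<in> ?R"
    then obtain e where e: "b = (tm_val e s', tm_val e t')" "holds p e \<phi>"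
      "V_rel p (tm_val e t') (tm_val e t')"
      by auto
    have "(tm_val e s, tm_val e t) \<in> A"
      using e(2) A(2) by blast
    then show "b \<in> ?B"
      using e(1,3) unfolding s'_def t'_def tm_val.simps tm_val_mult by blast
  qed
  then show ?thesis
    unfolding pairs_definable_def using A(1)
    by (intro exI[of _ "Conj \<phi> (V t' t')"] exI[of _ s'] exI[of _ t']) simp
qed

text \<open>The value forgets leading zeros; the second component keeps the length, which fixes the
  place value of a prefixed letter.\<close>

definition encode :: "nat \<Rightarrow> nat list \<Rightarrow> nat \<times> nat" where
  "encode p w = (word_val p w, p ^ length w)"

lemma encode_Cons:
  "encode p ` (#) a ` A = (\<lambda>(b, x). (b + a * x, p * x)) ` encode p ` A"
  by (auto simp: image_image encode_def word_val_Cons add.commute)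

text \<open>For each \<open>w\<close> in \<open>A\<close> the \<open>V_rel\<close> condition selects
  exactly those \<open>z\<close> that arise from some number \<open>n\<close> of copies of
  \<open>u\<close>.\<close>

lemma encode_power_prefix:
  assumes "p \<ge> 2" and "u \<noteq> []"
  defines "d \<equiv> p ^ length u - 1"
  shows "encode p ` {concat (replicate n u) @ w | n w. w \<in> A} =
    {(a + word_val p u * z, x + d * z) | a x z.
       (a, x) \<in> encode p ` A \<and> V_rel p (x + d * z) (x + d * z)}" (is "?L = ?R")
proof -
  have V: "V_rel p (p ^ length w + d * z) (p ^ length w + d * z) \<longleftrightarrow>
      (\<exists>n. z = p ^ length w * (\<Sum>i<n. p ^ (length u * i)))" for w :: "nat list" and z
    using power_plus_multiple_is_power_iff[OF assms(1), of "length u" "length w" z] assms(2)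
    by (simp add: V_rel_self_iff[OF assms(1)] d_def)
  have enc: "encode p (concat (replicate n u) @ w) =
      (word_val p w + word_val p u * z, p ^ length w + d * z)"
    if z: "z = p ^ length w * (\<Sum>i<n. p ^ (length u * i))" for n w z
  proof -
    have "p ^ length w + d * z = p ^ (length w + length u * n)"
      using power_plus_geometric_sum assms unfolding z d_def by simp
    then show ?thesis
      by (simp add: encode_def word_val_power_append z length_concat sum_list_replicate ac_simps)
  qed
  have "?R = {(word_val p w + word_val p u * z, p ^ length w + d * z) | w z.
      w \<in> A \<and> (\<exists>n. z = p ^ length w * (\<Sum>i<n. p ^ (length u * i)))}"
    using V by (auto simp: encode_def) blast+
  also have "\<dots> = ?L"
    using enc by (auto simp: image_iff) metis+
  finally show ?thesis by simp
qed

theorem theorem3: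
  fixes p :: nat
  assumes "p \<ge> 2"
  shows "PREG p \<subseteq> Sigma1_BA p"
proof
  fix S assume "S \<in> PREG p"
  then obtain L where L: "S = word_val p ` L" "regular_on {..<p} L" "polynomial_growth L"
    by (auto simp: PREG_def)
  interpret language_closure "{..<p}" "\<lambda>A. pairs_definable p (encode p ` A)"
    by unfold_locales
      (simp_all add: pairs_definable_empty pairs_definable_zero_one pairs_definable_Un image_Un
        encode_Cons pairs_definable_linear encode_power_prefix[OF assms] pairs_definable_V
        encode_def[of p "[]"] flip: One_nat_def)
  have "pairs_definable p (encode p ` L)"
  proof -
    obtain Q :: "nat set" and q\<^sub>0 \<delta> F where "dfa_on {..<p} Q q\<^sub>0 \<delta> F" "L = dfa_language {..<p} q\<^sub>0 \<delta> F"
      using L(2) unfolding regular_on_def by blast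
    then show ?thesis
      using L(3) closed_polynomial_growth by simp
  qed
  then obtain \<phi> s t where \<phi>: "quantifier_free \<phi>"
    "encode p ` L = {(tm_val e s, tm_val e t) | e. holds p e \<phi>}"
    unfolding pairs_definable_def by blast
  \<comment> \<open>Projecting to values drops the second term and leaves the image of one
    term.\<close>
  have "S = fst ` encode p ` L"
    by (simp add: L(1) encode_def image_image)
  also have "\<dots> = {tm_val e s | e. holds p e \<phi>}"
    unfolding \<phi>(2) by force
  finally show "S \<in> Sigma1_BA p"
    using Sigma1_BA_term_image[OF \<phi>(1)] by simp
qed

end
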